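(* Let $c\in(1,\infty)$, $\psi\in[0,\tfrac{\pi}{2})$ and $d\in(0,\infty)$, let $$C=c\begin{bmatrix}\cos\psi&-\sin\psi\\ \sin\psi&\cos\psi\end{bmatrix},\qquad A=d(C+I)^{-1}$$ acting on $\mathbb{R}^2$, and set $\sigma=\frac{d(1+c\cos\psi)}{1+2c\cos\psi+c^2}$ and $\beta=\frac{d}{1+c\cos\psi}$. Let $\gamma\in(0,\infty)$, $\delta=\sqrt{1-\frac{4\gamma\sigma}{1+2\gamma\sigma+\gamma^2\sigma\beta}}$ and $\xi=\arctan_2\left(\frac{2\gamma\sqrt{\sigma(\beta-\sigma)}}{1-\sigma\beta\gamma^2}\right)$. Suppose that $B$ is maximally monotone on $\mathbb{R}^2$ and satisfies either of the following: (i) if $\alpha\in(0,1]$: $B=B_1$ with $R_{\gamma B_1}=\begin{bmatrix}\cos\xi&\sin\xi\\ -\sin\xi&\cos\xi\end{bmatrix}$; (ii) if $\alpha\in(1,\tfrac{2}{1+\delta})$: $B=B_2$ with $R_{\gamma B_2}=\begin{bmatrix}\cos(\pi-\xi)&-\sin(\pi-\xi)\\ \sin(\pi-\xi)&\cos(\pi-\xi)\end{bmatrix}$. Then the sequence $(z^k)$ generated by the Douglas-Rachford algorithm $z^{k+1}=\big((1-\alpha)\mathrm{Id}+\alpha R_{\gamma A}R_{\gamma B}\big)z^k$ for solving $0\in\gamma Ax+\gamma Bx$ converges exactly with the rate $|1-\alpha|+\alpha\delta$.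
   Context: $\mathbb{R}^2$ carries the Euclidean inner product. For a maximally monotone operator $M$, the resolvent is $J_M=(\mathrm{Id}+M)^{-1}$ and the reflected resolvent is $R_M=2J_M-\mathrm{Id}$. For a numerator $x\ge0$ and a denominator $y\in\mathbb{R}$, $\arctan_2\left(\tfrac{x}{y}\right)$ (a function of the pair $(x,y)$) is defined as $\arctan(x/y)$ if $y>0$, as $\arctan(x/y)+\pi$ if $y<0$, and as $\tfrac{\pi}{2}$ if $y=0$; its values lie in $[0,\pi]$. "Converges exactly with rate $\rho$" means that $(z^k)$ converges to a fixed point $\bar z$ of the iteration operator $(1-\alpha)\mathrm{Id}+\alpha R_{\gamma A}R_{\gamma B}$ and $\|z^{k+1}-\bar z\|=\rho\|z^k-\bar z\|$ for all $k\ge0$. *)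

theory Defs
  imports "HOL-Analysis.Analysis"
begin

text \<open>Set-valued operators on \<open>'a\<close> are functions \<open>'a \<Rightarrow> 'a set\<close>. Set values are needed: for
  instance, the maximally monotone operator whose reflected resolvent is \<open>-Id\<close> is the normal
  cone of \<open>{0}\<close>, which is empty off the origin.\<close>

type_synonym 'a operator = "'a \<Rightarrow> 'a set"

definition operator_of :: "('a \<Rightarrow> 'a) \<Rightarrow> 'a operator" where
  "operator_of f = (\<lambda>x. {f x})"

definition op_scale :: "real \<Rightarrow> 'a::real_vector operator \<Rightarrow> 'a operator" where
  "op_scale c M = (\<lambda>x. (\<lambda>u. c *\<^sub>R u) ` M x)"

definition op_add :: "'a::real_vector operator \<Rightarrow> 'a operator \<Rightarrow> 'a operator" where
  "op_add M N = (\<lambda>x. {u + v |u v. u \<in> M x \<and> v \<in> N x})"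

definition op_inverse :: "'a operator \<Rightarrow> 'a operator" where
  "op_inverse M = (\<lambda>y. {x. y \<in> M x})"

definition monotone_operator :: "'a::real_inner operator \<Rightarrow> bool" where
  "monotone_operator M \<longleftrightarrow>
     (\<forall>x y. \<forall>u\<in>M x. \<forall>v\<in>M y. 0 \<le> (x - y) \<bullet> (u - v))"

definition maximally_monotone :: "'a::real_inner operator \<Rightarrow> bool" where
  "maximally_monotone M \<longleftrightarrow> monotone_operator M \<and>
     (\<forall>N. monotone_operator N \<and> (\<forall>x. M x \<subseteq> N x) \<longrightarrow> N = M)"

definition resolvent_op :: "'a::real_vector operator \<Rightarrow> 'a operator" where
  "resolvent_op M = op_inverse (op_add (operator_of id) M)"

text \<open>For maximally monotone \<open>M\<close> on a Hilbert space \<open>resolvent_op M x\<close> is a singleton for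
  every \<open>x\<close>: uniqueness is \<open>resolvent_op_unique\<close> below, existence is Minty's theorem. The
  resolvent as a function takes its element, and is unspecified where there is no unique one.\<close>

definition resolvent :: "'a::real_vector operator \<Rightarrow> 'a \<Rightarrow> 'a" where
  "resolvent M x = the_elem (resolvent_op M x)"

lemma resolvent_op_iff: "u \<in> resolvent_op M x \<longleftrightarrow> x - u \<in> M u"
  by (auto simp: resolvent_op_def op_inverse_def op_add_def operator_of_def algebra_simps
      intro!: exI[of _ "x - u"])

lemma resolvent_op_unique:
  assumes "monotone_operator M" "u \<in> resolvent_op M x" "v \<in> resolvent_op M x"
  shows "u = v"
proof -
  have "0 \<le> (u - v) \<bullet> ((x - u) - (x - v))"
    using assms unfolding monotone_operator_def resolvent_op_iff by blast
  also have "(x - u) - (x - v) = - (u - v)"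
    by simp
  finally have "(u - v) \<bullet> (u - v) \<le> 0"
    unfolding inner_minus_right by linarith
  then have "u - v = 0"
    using inner_ge_zero[of "u - v"] inner_eq_zero_iff[of "u - v"] by linarith
  then show ?thesis
    by simp
qed

definition reflected_resolvent :: "'a::real_vector operator \<Rightarrow> 'a \<Rightarrow> 'a" where
  "reflected_resolvent M x = 2 *\<^sub>R resolvent M x - x"

definition douglas_rachford ::
    "real \<Rightarrow> real \<Rightarrow> 'a::real_vector operator \<Rightarrow> 'a operator \<Rightarrow> 'a \<Rightarrow> 'a" where
  "douglas_rachford \<alpha> \<gamma> A B z = (1 - \<alpha>) *\<^sub>R z +
     \<alpha> *\<^sub>R reflected_resolvent (op_scale \<gamma> A) (reflected_resolvent (op_scale \<gamma> B) z)"

definition converges_exactly ::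
    "('a::real_normed_vector \<Rightarrow> 'a) \<Rightarrow> (nat \<Rightarrow> 'a) \<Rightarrow> real \<Rightarrow> bool" where
  "converges_exactly T z \<rho> \<longleftrightarrow>
     (\<exists>zbar. T zbar = zbar \<and> z \<longlonglongrightarrow> zbar \<and>
       (\<forall>k. norm (z (Suc k) - zbar) = \<rho> * norm (z k - zbar)))"

text \<open>The arguments are numerator and denominator; only used for \<open>x \<ge> 0\<close>.\<close>

definition arctan2 :: "real \<Rightarrow> real \<Rightarrow> real" where
  "arctan2 x y = (if y > 0 then arctan (x / y)
     else if y < 0 then arctan (x / y) + pi else pi / 2)"

end

theory Submission
  imports Defs
begin

text \<open>
  A matrix with rows \<open>(a, -b)\<close> and \<open>(b, a)\<close> acts on the plane as multiplication by the complex
  number \<open>a + b\<i>\<close>, and this correspondence respects sums, products and inverses. Under it, the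
  operator \<open>A\<close> becomes \<open>a = d / (1 + c cis \<psi>)\<close>, which satisfies \<open>Re a = \<sigma> > 0\<close>,
  \<open>\<bar>a\<bar>\<^sup>2 = \<sigma>\<beta>\<close> and \<open>Im a = -sqrt (\<sigma>(\<beta> - \<sigma>)) \<le> 0\<close>, and the reflected
  resolvent of \<open>\<gamma>A\<close> becomes \<open>(1 - \<gamma>a) / (1 + \<gamma>a)\<close> (lemma \<open>reflected_resolvent_cmat\<close>).
  That number is \<open>\<delta> cis \<xi>\<close> (lemmas \<open>cmod_cayley\<close> and \<open>cayley_polar\<close>), including the
  degenerate case in which it vanishes and \<open>\<delta> = 0\<close>.

  The reflected resolvent of \<open>\<gamma>B\<close> is the rotation by \<open>-\<xi>\<close> or by \<open>\<pi> - \<xi>\<close>, so its composition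
  with that of \<open>\<gamma>A\<close> is \<open>\<delta> Id\<close> or \<open>-\<delta> Id\<close>. The iteration operator is therefore the real
  multiple \<open>(1 - \<alpha> \<plusminus> \<alpha>\<delta>) Id\<close> of the identity, and the sign is the one for which the
  two terms do not cancel: the factor has modulus \<open>\<bar>1 - \<alpha>\<bar> + \<alpha>\<delta>\<close>, which is below \<open>1\<close>
  by the restrictions on \<open>\<alpha>\<close> and by \<open>\<delta> < 1\<close>. The fixed point is the origin.
\<close>

section \<open>Complex numbers as matrices\<close>

text \<open>The matrix of multiplication by \<open>w\<close>, in the basis \<open>1, \<i>\<close> of the complex plane.\<close>

definition cmat :: "complex \<Rightarrow> real^2^2" where
  "cmat w = vector [vector [Re w, - Im w], vector [Im w, Re w]]"

lemma cmat_add: "cmat v + cmat w = cmat (v + w)"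
  by (simp add: cmat_def vec_eq_iff forall_2)

lemma cmat_scaleR: "r *\<^sub>R cmat w = cmat (of_real r * w)"
  by (simp add: cmat_def vec_eq_iff forall_2)

lemma cmat_of_real: "cmat (of_real r) = mat r"
  by (simp add: cmat_def vec_eq_iff forall_2 mat_def)

lemma cmat_mult: "cmat v ** cmat w = cmat (v * w)"
  by (simp add: cmat_def vec_eq_iff forall_2 matrix_matrix_mult_def sum_2 algebra_simps)

lemma cmat_of_real_vector: "cmat (of_real r) *v x = r *\<^sub>R x"
  by (simp add: cmat_def vec_eq_iff forall_2 matrix_vector_mult_def sum_2)

lemma matrix_inv_cmat:
  assumes "w \<noteq> 0"
  shows "matrix_inv (cmat w) = cmat (inverse w)"
proof -
  have "cmat w ** cmat (inverse w) = mat 1" "cmat (inverse w) ** cmat w = mat 1"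
    using assms cmat_of_real[of 1] by (simp_all add: cmat_mult)
  then show ?thesis
    unfolding matrix_inv_def
    by (intro some_equality)
      (auto, metis matrix_mul_assoc matrix_mul_lid matrix_mul_rid)
qed

section \<open>Reflected resolvents of multiplication operators\<close>

lemma cmat_vector_add: "cmat v *v x + cmat w *v x = cmat (v + w) *v x"
  by (simp add: cmat_add[symmetric] matrix_vector_mult_add_rdistrib)

lemma cmat_vector_diff: "cmat v *v x - cmat w *v x = cmat (v - w) *v x"
  by (metis add_diff_cancel_right' cmat_vector_add diff_add_cancel)

lemma cmat_vector_scaleR: "r *\<^sub>R (cmat w *v x) = cmat (of_real r * w) *v x"
  by (simp add: cmat_scaleR[symmetric] scaleR_matrix_vector_assoc)

lemma cmat_vector_mult: "cmat v *v (cmat w *v x) = cmat (v * w) *v x"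
  by (simp add: cmat_mult matrix_vector_mul_assoc)

lemma cmat_one_vector: "cmat 1 *v x = x"
  using cmat_of_real_vector[of 1 x] by simp

lemma resolvent_cmat:
  assumes "1 + of_real \<gamma> * a \<noteq> 0"
  shows "resolvent (op_scale \<gamma> (operator_of (\<lambda>x. cmat a *v x))) x
           = cmat (inverse (1 + of_real \<gamma> * a)) *v x"
proof -
  let ?M = "op_scale \<gamma> (operator_of (\<lambda>x. cmat a *v x))"
  let ?b = "1 + of_real \<gamma> * a"
  have "u \<in> resolvent_op ?M x \<longleftrightarrow> u = cmat (inverse ?b) *v x" for u
  proof -
    have "u \<in> resolvent_op ?M x \<longleftrightarrow> x - u = cmat (of_real \<gamma> * a) *v u"
      by (simp add: resolvent_op_iff op_scale_def operator_of_def cmat_vector_scaleR)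
    also have "\<dots> \<longleftrightarrow> x = cmat ?b *v u"
      by (simp add: cmat_vector_add[symmetric] cmat_one_vector diff_eq_eq add.commute)
    also have "\<dots> \<longleftrightarrow> u = cmat (inverse ?b) *v x"
    proof
      assume "x = cmat ?b *v u"
      then show "u = cmat (inverse ?b) *v x"
        using assms by (simp add: cmat_vector_mult cmat_one_vector)
    next
      assume "u = cmat (inverse ?b) *v x"
      then show "x = cmat ?b *v u"
        using assms by (simp add: cmat_vector_mult cmat_one_vector)
    qed
    finally show ?thesis .
  qed
  then have "resolvent_op ?M x = {cmat (inverse ?b) *v x}"
    by blast
  then show ?thesis
    by (simp add: resolvent_def)
qed

lemma reflected_resolvent_cmat:
  assumes "1 + of_real \<gamma> * a \<noteq> 0"
  shows "reflected_resolvent (op_scale \<gamma> (operator_of (\<lambda>x. cmat a *v x))) x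
           = cmat ((1 - of_real \<gamma> * a) / (1 + of_real \<gamma> * a)) *v x"
proof -
  have "of_real 2 * inverse (1 + of_real \<gamma> * a) - 1
          = (1 - of_real \<gamma> * a) / (1 + of_real \<gamma> * a)"
    using assms by (simp add: field_simps)
  moreover have "cmat (of_real 2 * inverse (1 + of_real \<gamma> * a)) *v x - x
          = cmat (of_real 2 * inverse (1 + of_real \<gamma> * a) - 1) *v x"
    using cmat_vector_diff[of _ x 1] by (simp add: cmat_one_vector)
  ultimately show ?thesis
    using assms by (simp add: reflected_resolvent_def resolvent_cmat cmat_vector_scaleR)
qed

section \<open>Polar form of the Cayley transform\<close>

text \<open>For \<open>x \<ge> 0\<close>, \<open>arctan2 x y\<close> is an argument of \<open>y + x\<i>\<close>. At the origin any angle would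
  do, since the modulus vanishes there.\<close>

lemma arctan2_polar:
  assumes "0 \<le> x"
  shows "Complex y x = of_real (cmod (Complex y x)) * cis (arctan2 x y)"
proof (cases "y = 0")
  case True
  then show ?thesis
    using assms by (simp add: arctan2_def complex_eq_iff cmod_def)
next
  case False
  have "sqrt (x\<^sup>2 + y\<^sup>2) = \<bar>y\<bar> * sqrt (1 + (x / y)\<^sup>2)"
    using False by (simp add: real_sqrt_mult[symmetric] real_sqrt_abs[symmetric] field_simps
        del: real_sqrt_abs)
  moreover have "sqrt (1 + (x / y)\<^sup>2) > 0"
    by (simp add: add_pos_nonneg)
  ultimately show ?thesis
    using False
    by (auto simp: arctan2_def complex_eq_iff cmod_def cos_arctan sin_arctan add.commute)
qed

text \<open>Multiplying numerator and denominator by the conjugate of \<open>1 + \<gamma>a\<close> gives the numerator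
  \<open>1 - \<gamma>\<^sup>2 \<bar>a\<bar>\<^sup>2 - 2 \<gamma> Im a \<i>\<close>, whose argument is therefore that of the quotient.
  For \<open>1 + \<gamma>a = 0\<close> both sides are \<open>0\<close>, by the convention for division by zero.\<close>

lemma cayley_polar:
  assumes "0 \<le> \<gamma>" "Im a \<le> 0"
  shows "(1 - of_real \<gamma> * a) / (1 + of_real \<gamma> * a)
           = of_real (cmod ((1 - of_real \<gamma> * a) / (1 + of_real \<gamma> * a)))
             * cis (arctan2 (2 * \<gamma> * - Im a) (1 - (cmod a)\<^sup>2 * \<gamma>\<^sup>2))"
proof -
  let ?p = "1 - of_real \<gamma> * a" and ?q = "1 + of_real \<gamma> * a"
  let ?v = "Complex (1 - (cmod a)\<^sup>2 * \<gamma>\<^sup>2) (2 * \<gamma> * - Im a)"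
  let ?\<theta> = "arctan2 (2 * \<gamma> * - Im a) (1 - (cmod a)\<^sup>2 * \<gamma>\<^sup>2)"
  have v: "?p * cnj ?q = ?v"
    unfolding cmod_power2 by (simp add: complex_eq_iff power2_eq_square algebra_simps)
  have q: "?p / ?q = ?v / of_real ((cmod ?q)\<^sup>2)"
    by (metis v complex_div_cnj of_real_power)
  have norm_q: "cmod (?p / ?q) = cmod ?v / (cmod ?q)\<^sup>2"
    unfolding q norm_divide by (simp add: norm_power)
  have "?v = of_real (cmod ?v) * cis ?\<theta>"
    using assms by (intro arctan2_polar) (simp add: mult_nonneg_nonpos)
  then have "?v / of_real ((cmod ?q)\<^sup>2)
               = of_real (cmod ?v) * cis ?\<theta> / of_real ((cmod ?q)\<^sup>2)"
    by (rule arg_cong)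
  also have "\<dots> = of_real (cmod ?v / (cmod ?q)\<^sup>2) * cis ?\<theta>"
    by simp
  finally show ?thesis
    unfolding norm_q using q by (rule trans[rotated])
qed

lemma cmod_cayley:
  assumes "1 + of_real \<gamma> * a \<noteq> 0"
  shows "cmod ((1 - of_real \<gamma> * a) / (1 + of_real \<gamma> * a))
           = sqrt (1 - 4 * \<gamma> * Re a / (1 + 2 * \<gamma> * Re a + \<gamma>\<^sup>2 * (cmod a)\<^sup>2))"
proof -
  let ?p = "1 - of_real \<gamma> * a" and ?q = "1 + of_real \<gamma> * a"
  have q: "(cmod ?q)\<^sup>2 = 1 + 2 * \<gamma> * Re a + \<gamma>\<^sup>2 * (cmod a)\<^sup>2"
    unfolding cmod_power2 by (simp add: power2_eq_square algebra_simps)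
  have p: "(cmod ?p)\<^sup>2 = (cmod ?q)\<^sup>2 - 4 * \<gamma> * Re a"
    unfolding cmod_power2 by (simp add: power2_eq_square algebra_simps)
  have "(cmod (?p / ?q))\<^sup>2 = ((cmod ?q)\<^sup>2 - 4 * \<gamma> * Re a) / (cmod ?q)\<^sup>2"
    by (simp only: norm_divide power_divide p)
  also have "\<dots> = 1 - 4 * \<gamma> * Re a / (cmod ?q)\<^sup>2"
    using assms by (simp add: diff_divide_distrib)
  finally show ?thesis
    unfolding q by (metis norm_ge_zero real_sqrt_unique)
qed

section \<open>The exact rate\<close>

lemma converges_exactly_scaleR:
  fixes z :: "nat \<Rightarrow> 'a::real_normed_vector"
  assumes T: "\<And>x. T x = t *\<^sub>R x" and t: "\<bar>t\<bar> < 1" and z: "\<And>k. z (Suc k) = T (z k)"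
  shows "converges_exactly T z \<bar>t\<bar>"
proof -
  have iterates: "z k = t ^ k *\<^sub>R z 0" for k
    by (induction k) (simp_all add: z T)
  have "(\<lambda>k. t ^ k *\<^sub>R z 0) \<longlonglongrightarrow> 0 *\<^sub>R z 0"
    using t by (intro tendsto_scaleR tendsto_const LIMSEQ_power_zero) simp
  then have "z \<longlonglongrightarrow> 0"
    by (simp flip: iterates)
  then show ?thesis
    unfolding converges_exactly_def by (intro exI[of _ 0]) (simp add: z T)
qed

theorem proposition7p7:
  fixes c \<psi> d \<sigma> \<beta> \<gamma> \<delta> \<xi> \<alpha> :: real
    and C A :: "real^2^2"
    and B :: "(real^2) operator"
    and z :: "nat \<Rightarrow> real^2"
  assumes c: "1 < c"
    and psi: "0 \<le> \<psi>" "\<psi> < pi / 2"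
    and d: "0 < d"
    and C: "C = c *\<^sub>R vector [vector [cos \<psi>, - sin \<psi>], vector [sin \<psi>, cos \<psi>]]"
    and A: "A = d *\<^sub>R matrix_inv (C + mat 1)"
    and sigma: "\<sigma> = d * (1 + c * cos \<psi>) / (1 + 2 * c * cos \<psi> + c\<^sup>2)"
    and beta: "\<beta> = d / (1 + c * cos \<psi>)"
    and gamma: "0 < \<gamma>"
    and delta: "\<delta> = sqrt (1 - 4 * \<gamma> * \<sigma> / (1 + 2 * \<gamma> * \<sigma> + \<gamma>\<^sup>2 * \<sigma> * \<beta>))"
    and xi: "\<xi> = arctan2 (2 * \<gamma> * sqrt (\<sigma> * (\<beta> - \<sigma>))) (1 - \<sigma> * \<beta> * \<gamma>\<^sup>2)"
    and B: "maximally_monotone B"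
    and cases:
      "(0 < \<alpha> \<and> \<alpha> \<le> 1 \<and>
          reflected_resolvent (op_scale \<gamma> B) =
            (\<lambda>x. vector [vector [cos \<xi>, sin \<xi>], vector [- sin \<xi>, cos \<xi>]] *v x))
       \<or> (1 < \<alpha> \<and> \<alpha> < 2 / (1 + \<delta>) \<and>
          reflected_resolvent (op_scale \<gamma> B) =
            (\<lambda>x. vector [vector [cos (pi - \<xi>), - sin (pi - \<xi>)],
                         vector [sin (pi - \<xi>), cos (pi - \<xi>)]] *v x))"
    and z: "\<forall>k. z (Suc k) = douglas_rachford \<alpha> \<gamma> (operator_of (\<lambda>x. A *v x)) B (z k)"
  shows "converges_exactly (douglas_rachford \<alpha> \<gamma> (operator_of (\<lambda>x. A *v x)) B) z
           (\<bar>1 - \<alpha>\<bar> + \<alpha> * \<delta>)"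
proof -
  define w where "w = of_real c * cis \<psi>"
  define a where "a = of_real d / (w + 1)"
  define n where "n = 1 + 2 * c * cos \<psi> + c\<^sup>2"
  have cos_pos: "0 < cos \<psi>" and sin_nonneg: "0 \<le> sin \<psi>"
    using psi by (auto intro!: cos_gt_zero_pi sin_ge_zero)
  have k: "0 < 1 + c * cos \<psi>"
    using c cos_pos by (simp add: add_pos_pos)
  then have w: "w + 1 \<noteq> 0"
    by (auto simp: w_def complex_eq_iff)
  have "c\<^sup>2 * (cos \<psi>)\<^sup>2 + c\<^sup>2 * (sin \<psi>)\<^sup>2 = c\<^sup>2"
    by (simp flip: distrib_left)
  then have n: "(cmod (w + 1))\<^sup>2 = n"
    unfolding cmod_power2 by (simp add: n_def w_def power2_sum power_mult_distrib algebra_simps)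
  have n_pos: "0 < n"
    using w n by (metis zero_less_norm_iff zero_less_power)

  have "C + mat 1 = cmat (w + 1)"
    unfolding C w_def cmat_of_real[of 1, symmetric]
    by (simp add: cmat_def vec_eq_iff forall_2)
  then have A_cmat: "A = cmat a"
    using A w by (simp add: matrix_inv_cmat cmat_scaleR a_def divide_inverse)

  have n': "(Re (w + 1))\<^sup>2 + (Im (w + 1))\<^sup>2 = n"
    using n by (simp add: cmod_power2)
  have Re_a: "Re a = \<sigma>"
    using n' by (simp add: a_def Re_divide sigma n_def w_def)
  have norm_a: "(cmod a)\<^sup>2 = \<sigma> * \<beta>"
    using k n d by (simp add: a_def norm_divide power_divide sigma beta n_def power2_eq_square)
  have "Im a = - (d * c * sin \<psi> / n)"
    using n' by (simp add: a_def Im_divide w_def)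
  then have Im_a: "Im a \<le> 0"
    using c d n_pos sin_nonneg by simp
  have "\<sigma> * (\<beta> - \<sigma>) = (- Im a)\<^sup>2"
    using norm_a Re_a cmod_power2[of a] by (simp add: algebra_simps power2_eq_square)
  then have sqrt_eq: "sqrt (\<sigma> * (\<beta> - \<sigma>)) = - Im a"
    using Im_a by (simp add: real_sqrt_unique)
  have sigma_pos: "0 < \<sigma>" and beta_pos: "0 < \<beta>"
    using d k n_pos by (simp_all add: sigma beta n_def)

  have "0 < Re (1 + of_real \<gamma> * a)"
    using gamma sigma_pos by (simp add: Re_a add_pos_pos)
  then have nz: "1 + of_real \<gamma> * a \<noteq> 0"
    by (metis less_irrefl zero_complex.simps(1))
  have delta_norm: "\<delta> = cmod ((1 - of_real \<gamma> * a) / (1 + of_real \<gamma> * a))"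
    by (simp only: cmod_cayley[OF nz] delta norm_a Re_a mult.assoc)
  have polar: "(1 - of_real \<gamma> * a) / (1 + of_real \<gamma> * a) = of_real \<delta> * cis \<xi>"
    using cayley_polar[of \<gamma> a] gamma Im_a unfolding delta_norm xi sqrt_eq norm_a by simp
  have delta_nonneg: "0 \<le> \<delta>"
    by (simp add: delta_norm)
  have delta_less: "\<delta> < 1"
    unfolding delta using gamma sigma_pos beta_pos by (simp add: add_pos_pos)

  define T where "T = douglas_rachford \<alpha> \<gamma> (operator_of (\<lambda>x. A *v x)) B"
  have step: "T x = ((1 - \<alpha>) + \<alpha> * s) *\<^sub>R x"
    if R: "reflected_resolvent (op_scale \<gamma> B) x = cmat u *v x"
      and s: "of_real \<delta> * cis \<xi> * u = of_real s" for x u s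
    unfolding T_def douglas_rachford_def A_cmat R reflected_resolvent_cmat[OF nz] polar
    by (simp add: cmat_vector_mult s cmat_of_real_vector scaleR_add_left)
  have zT: "z (Suc k) = T (z k)" for k
    using z by (simp add: T_def)

  have "\<exists>t. (\<forall>x. T x = t *\<^sub>R x) \<and> \<bar>t\<bar> < 1 \<and> \<bar>t\<bar> = \<bar>1 - \<alpha>\<bar> + \<alpha> * \<delta>"
    using cases
  proof (elim disjE conjE)
    assume alpha: "0 < \<alpha>" "\<alpha> \<le> 1"
      and R: "reflected_resolvent (op_scale \<gamma> B) =
            (\<lambda>x. vector [vector [cos \<xi>, sin \<xi>], vector [- sin \<xi>, cos \<xi>]] *v x)"
    \<comment> \<open>The rotation by \<open>-\<xi>\<close> undoes the rotation in \<open>\<delta> cis \<xi>\<close>.\<close>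
    have "T x = ((1 - \<alpha>) + \<alpha> * \<delta>) *\<^sub>R x" for x
      by (rule step[of _ "cis (- \<xi>)"]) (simp_all add: R cmat_def cis_mult mult.assoc)
    moreover have "\<alpha> * \<delta> < \<alpha>"
      using alpha delta_less by simp
    moreover have "0 \<le> \<alpha> * \<delta>"
      using alpha delta_nonneg by simp
    ultimately show ?thesis
      using alpha by (intro exI[of _ "(1 - \<alpha>) + \<alpha> * \<delta>"]) auto
  next
    assume alpha: "1 < \<alpha>" "\<alpha> < 2 / (1 + \<delta>)"
      and R: "reflected_resolvent (op_scale \<gamma> B) =
            (\<lambda>x. vector [vector [cos (pi - \<xi>), - sin (pi - \<xi>)],
                         vector [sin (pi - \<xi>), cos (pi - \<xi>)]] *v x)"
    \<comment> \<open>Here the two rotations add up to the angle \<open>\<pi>\<close>, so both summands are nonpositive.\<close>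
    have "T x = ((1 - \<alpha>) + \<alpha> * (- \<delta>)) *\<^sub>R x" for x
      by (rule step[of _ "cis (pi - \<xi>)"])
        (simp_all add: R cmat_def cis_mult mult.assoc del: cos_pi_minus sin_pi_minus)
    moreover have "\<alpha> + \<alpha> * \<delta> < 2"
      using alpha delta_nonneg by (simp add: field_simps)
    moreover have "0 \<le> \<alpha> * \<delta>"
      using alpha delta_nonneg by simp
    ultimately show ?thesis
      using alpha by (intro exI[of _ "(1 - \<alpha>) + \<alpha> * (- \<delta>)"]) auto
  qed
  then obtain t where "\<And>x. T x = t *\<^sub>R x" "\<bar>t\<bar> < 1" "\<bar>t\<bar> = \<bar>1 - \<alpha>\<bar> + \<alpha> * \<delta>"
    by blast
  then show ?thesis
    using converges_exactly_scaleR[of T t z] zT unfolding T_def by metis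
qed

end
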